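(* Let $f=(f_1,\dots,f_g):\mathbb{R}^n\times\mathbb{R}^m\to\mathbb{R}^g$ be continuously differentiable in the box $\mathbf{\Omega}=\mathcal{X}\times\mathcal{U}\subset\mathbb{R}^n\times\mathbb{R}^m$. Then $f$ is locally Lipschitz continuous in $\mathbf{\Omega}$ in the sense that for all $(x,u),(\hat x,u)\in\mathbf{\Omega}$ $$\|f(x,u)-f(\hat x,u)\|_2\le \gamma_{l_1}\,\|x-\hat x\|_2,$$ where $$\gamma_{l_1}=\Bigg(\max_{(x,u)\in\mathbf{\Omega}}\ \sum_{i=1}^{g}\|\nabla_x f_i(x,u)\|_2^2\Bigg)^{1/2}.$$
   Context: Standing assumptions: $\mathcal{X}\subset\mathbb{R}^n$ and $\mathcal{U}\subset\mathbb{R}^m$, and $\mathbf{\Omega}=\mathcal{X}\times\mathcal{U}$ is a nonempty box, i.e. a product of $n+m$ compact intervals $[\underline{\omega}_i,\overline{\omega}_i]$ with $\underline{\omega}_i,\overline{\omega}_i\in\mathbb{R}$; $f$ is of class $C^1$ in $\mathbf{\Omega}$ (differentiable at the points of $\mathbf{\Omega}$ with partial derivatives continuous on $\mathbf{\Omega}$). $\nabla_x f_i$ denotes the gradient of $f_i$ with respect to the first argument $x\in\mathbb{R}^n$ only; $\|\cdot\|_2$ is the Euclidean norm. *)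

theory Defs
  imports "HOL-Analysis.Analysis"
begin

definition partial_deriv :: "('a::euclidean_space \<Rightarrow> real) \<Rightarrow> 'a \<Rightarrow> 'a \<Rightarrow> real" where
  "partial_deriv h b p = deriv (\<lambda>t. h (p + t *\<^sub>R b)) 0"

(* Differentiability is two-sided, in the whole ambient space, also at boundary points of S
   (the functions considered are defined everywhere).  The partial derivatives are only
   required to be continuous relative to S. *)
definition C1_in :: "('a::euclidean_space \<Rightarrow> real ^ 'g) \<Rightarrow> 'a set \<Rightarrow> bool" where
  "C1_in f S \<longleftrightarrow>
     (\<forall>p\<in>S. f differentiable (at p)) \<and>
     (\<forall>i. \<forall>b\<in>Basis. continuous_on S (partial_deriv (\<lambda>p. f p $ i) b))"

definition grad_x :: "((real ^ 'n) \<times> (real ^ 'm) \<Rightarrow> real) \<Rightarrow> (real ^ 'n) \<times> (real ^ 'm) \<Rightarrow> real ^ 'n" where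
  "grad_x h p = (\<chi> j. partial_deriv (\<lambda>y. h (y, snd p)) (axis j 1) (fst p))"

definition sum_sq_grad_x :: "((real ^ 'n) \<times> (real ^ 'm) \<Rightarrow> real ^ 'g) \<Rightarrow> (real ^ 'n) \<times> (real ^ 'm) \<Rightarrow> real" where
  "sum_sq_grad_x f p = (\<Sum>i\<in>UNIV. (norm (grad_x (\<lambda>q. f q $ i) p))\<^sup>2)"

(* The supremum of a real-valued function is unspecified when the function is unbounded, so
   this is the intended maximum only where the maximum over S is known to be attained. *)
definition gamma_l1 :: "((real ^ 'n) \<times> (real ^ 'm) \<Rightarrow> real ^ 'g) \<Rightarrow> ((real ^ 'n) \<times> (real ^ 'm)) set \<Rightarrow> real" where
  "gamma_l1 f S = sqrt (SUP p\<in>S. sum_sq_grad_x f p)"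

end

(* Mean value inequality in the variable x on the convex slice X: by Cauchy-Schwarz in each component,
   the operator norm of the x-derivative is at most its Frobenius norm, the square root of
   the sum of the squared gradients, which attains its maximum on the compact box. *)
theory Submission
  imports Defs
begin

text \<open>Chain rule along the line \<open>t \<mapsto> p + t *\<^sub>R b\<close>: this ties the
  one-variable limit behind \<open>partial_deriv\<close> to the Frechet derivative.\<close>

lemma partial_deriv_eq:
  assumes "(h has_derivative h') (at p)"
  shows "partial_deriv h b p = h' b"
proof -
  have lin: "linear h'"
    using assms by (rule has_derivative_linear)
  have "((\<lambda>t::real. p + t *\<^sub>R b) has_derivative (\<lambda>t. t *\<^sub>R b)) (at 0)"
    by (auto intro!: derivative_eq_intros)
  moreover have "(h has_derivative h') (at (p + (0::real) *\<^sub>R b))"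
    using assms by simp
  ultimately have "((\<lambda>t::real. h (p + t *\<^sub>R b)) has_derivative (\<lambda>t. h' (t *\<^sub>R b))) (at 0)"
    by (rule has_derivative_compose)
  moreover have "(\<lambda>t. h' (t *\<^sub>R b)) = (*) (h' b)"
    using lin by (auto simp: linear_scale)
  ultimately have "((\<lambda>t::real. h (p + t *\<^sub>R b)) has_field_derivative h' b) (at 0)"
    by (simp add: has_field_derivative_def)
  then show ?thesis
    unfolding partial_deriv_def by (rule DERIV_imp_deriv)
qed

text \<open>Moving along \<open>(axis j 1, 0)\<close> leaves the second component fixed, so both
  sides are the derivative of the same function of \<open>t\<close>. Facts about partial derivatives
  on the product space thus apply to \<open>grad_x\<close>.\<close>

lemma grad_x_nth: "grad_x h p $ j = partial_deriv h (axis j 1, 0) p"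
  by (cases p) (simp add: grad_x_def partial_deriv_def)

text \<open>Expand \<open>v\<close> in the standard basis and use linearity of \<open>h'\<close> on
  vectors of the form \<open>(w, 0)\<close>; its values on the basis are the entries of the
  gradient.\<close>

lemma grad_x_inner:
  assumes "(h has_derivative h') (at p)"
  shows "grad_x h p \<bullet> v = h' (v, 0)"
proof -
  have lin: "linear (\<lambda>w. h' (w, 0))"
    using bounded_linear_compose[OF has_derivative_bounded_linear[OF assms]
        bounded_linear_Pair[OF bounded_linear_ident bounded_linear_zero]]
    by (rule bounded_linear.linear)
  have "h' (\<Sum>j\<in>UNIV. (v $ j) *\<^sub>R axis j 1, 0) = (\<Sum>j\<in>UNIV. v $ j * h' (axis j 1, 0))"
    using linear_sum[OF lin, of "\<lambda>j. (v $ j) *\<^sub>R axis j 1" UNIV]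
    by (simp add: linear_scale[OF lin])
  then show ?thesis
    by (simp add: inner_vec_def grad_x_nth partial_deriv_eq[OF assms] mult.commute
        basis_expansion scalar_mult_eq_scaleR[symmetric])
qed

lemma norm_derivative_x_le:
  fixes f :: "(real ^ 'n) \<times> (real ^ 'm) \<Rightarrow> real ^ 'g"
  assumes "(f has_derivative f') (at p)"
  shows "norm (f' (v, 0)) \<le> sqrt (sum_sq_grad_x f p) * norm v"
proof -
  have component: "((\<lambda>q. f q $ i) has_derivative (\<lambda>w. f' w $ i)) (at p)" for i
    using bounded_linear_vec_nth assms by (rule bounded_linear.has_derivative)
  have "(norm (f' (v, 0)))\<^sup>2 = (\<Sum>i\<in>UNIV. (grad_x (\<lambda>q. f q $ i) p \<bullet> v)\<^sup>2)"
    by (simp add: norm_vec_def L2_set_def sum_nonneg grad_x_inner[OF component])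
  also have "\<dots> \<le> (\<Sum>i\<in>UNIV. (norm (grad_x (\<lambda>q. f q $ i) p))\<^sup>2 * (norm v)\<^sup>2)"
    by (intro sum_mono) (metis Cauchy_Schwarz_ineq power2_norm_eq_inner)
  also have "\<dots> = sum_sq_grad_x f p * (norm v)\<^sup>2"
    by (simp add: sum_sq_grad_x_def sum_distrib_right)
  finally have "norm (f' (v, 0)) \<le> sqrt (sum_sq_grad_x f p * (norm v)\<^sup>2)"
    by (rule real_le_rsqrt)
  then show ?thesis
    by (simp add: real_sqrt_mult)
qed

lemma continuous_on_sum_sq_grad_x:
  fixes f :: "(real ^ 'n) \<times> (real ^ 'm) \<Rightarrow> real ^ 'g"
  assumes "C1_in f S"
  shows "continuous_on S (sum_sq_grad_x f)"
proof -
  \<comment> \<open>These vectors are among the directions for which \<open>C1_in\<close> supplies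
    continuity, and they give all components of \<open>grad_x\<close>.\<close>
  have "(axis j 1, 0) \<in> (Basis :: ((real ^ 'n) \<times> (real ^ 'm)) set)" for j
    by (simp add: Basis_prod_def axis_in_Basis_iff)
  then have "continuous_on S (grad_x (\<lambda>q. f q $ i))" for i
    using assms
    by (auto simp: C1_in_def continuous_on_componentwise[of S "grad_x _"] Basis_vec_def
        cart_eq_inner_axis[symmetric] grad_x_nth)
  then show ?thesis
    unfolding sum_sq_grad_x_def by (intro continuous_intros)
qed

theorem theorem1:
  fixes f :: "(real ^ 'n) \<times> (real ^ 'm) \<Rightarrow> real ^ 'g"
    and a b :: "real ^ 'n" and c d :: "real ^ 'm"
    and X :: "(real ^ 'n) set" and U :: "(real ^ 'm) set"
  assumes "X = cbox a b" and "U = cbox c d" and "X \<times> U \<noteq> {}"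
    and "C1_in f (X \<times> U)"
  shows "(\<exists>p\<in>X \<times> U. \<forall>q\<in>X \<times> U. sum_sq_grad_x f q \<le> sum_sq_grad_x f p) \<and>
    (\<forall>x xh u. (x, u) \<in> X \<times> U \<longrightarrow> (xh, u) \<in> X \<times> U \<longrightarrow>
       norm (f (x, u) - f (xh, u)) \<le> gamma_l1 f (X \<times> U) * norm (x - xh))"
proof (intro conjI allI impI)
  have "compact (X \<times> U)"
    using assms by (simp add: compact_Times)
  then show max: "\<exists>p\<in>X \<times> U. \<forall>q\<in>X \<times> U. sum_sq_grad_x f q \<le> sum_sq_grad_x f p"
    using assms continuous_on_sum_sq_grad_x by (intro continuous_attains_sup)
  fix x xh u
  assume x: "(x, u) \<in> X \<times> U" and xh: "(xh, u) \<in> X \<times> U"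
  \<comment> \<open>The derivative is taken in the whole product space, which \<open>C1_in\<close>
    permits even at boundary points of the box; only afterwards is it restricted to the slice at
    height \<open>u\<close>.\<close>
  define f' where "f' y = frechet_derivative f (at (y, u))" for y
  have f': "(f has_derivative f' y) (at (y, u))" if "y \<in> X" for y
    using assms(4) x that unfolding f'_def C1_in_def
    by (auto simp: frechet_derivative_works[symmetric])
  \<comment> \<open>The attained maximum bounds the image, so the supremum inside
    \<open>gamma_l1\<close> is a genuine upper bound and not an unspecified value.\<close>
  have bdd: "bdd_above (sum_sq_grad_x f ` (X \<times> U))"
    using max by (force intro: bdd_aboveI2)
  show "norm (f (x, u) - f (xh, u)) \<le> gamma_l1 f (X \<times> U) * norm (x - xh)"
  proof (rule differentiable_bound)
    show "convex X"
      using assms by simp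
    fix y assume y: "y \<in> X"
    \<comment> \<open>Composing with the embedding of the slice turns the full derivative into the
      derivative in the first argument, applied to vectors \<open>(v, 0)\<close>.\<close>
    have "((\<lambda>y. (y, u)) has_derivative (\<lambda>v. (v, 0))) (at y within X)"
      by (auto intro!: derivative_eq_intros)
    then show "((\<lambda>y. f (y, u)) has_derivative (\<lambda>v. f' y (v, 0))) (at y within X)"
      using f'[OF y] by (rule has_derivative_compose)
    have "sum_sq_grad_x f (y, u) \<le> (SUP p\<in>X \<times> U. sum_sq_grad_x f p)"
      using x y by (intro cSUP_upper bdd) auto
    then have "sqrt (sum_sq_grad_x f (y, u)) \<le> gamma_l1 f (X \<times> U)"
      by (simp add: gamma_l1_def)
    then have "norm (f' y (v, 0)) \<le> gamma_l1 f (X \<times> U) * norm v" for v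
      using norm_derivative_x_le[OF f'[OF y], of v]
      by (meson mult_right_mono norm_ge_zero order_trans)
    then show "onorm (\<lambda>v. f' y (v, 0)) \<le> gamma_l1 f (X \<times> U)"
      by (rule onorm_le)
  qed (use x xh in auto)
qed

end
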